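(* For all $n\geq1$ and all $k\geq1$ (natural number) or $k=\mathbb{N}$ (with the convention $\mathbb{N}+1=\mathbb{N}$): $\mathrm{RT}_{n,\mathbb{N}}\times\mathrm{RT}_{n+1,k}\leq_{sW}\mathrm{RT}_{n+1,k+1}$ and $\mathrm{SRT}_{n,\mathbb{N}}\times\mathrm{SRT}_{n+1,k}\leq_{sW}\mathrm{SRT}_{n+1,k+1}$.
   Context: Weihrauch framework. A represented space is a set $X$ with a surjective partial map $\delta_X:\subseteq\mathbb{N}^{\mathbb{N}}\to X$. A problem is a partial multi-valued function $f:\subseteq X\rightrightarrows Y$; a partial $F:\subseteq\mathbb{N}^{\mathbb{N}}\to\mathbb{N}^{\mathbb{N}}$ realizes $f$ if $\delta_Y(F(p))\in f(\delta_X(p))$ whenever $\delta_X(p)\in\mathrm{dom}(f)$. $f\leq_{sW}g$ means there are computable partial $H,K:\subseteq\mathbb{N}^{\mathbb{N}}\to\mathbb{N}^{\mathbb{N}}$ with $H\circ G\circ K$ realizing $f$ for every realizer $G$ of $g$. The product $f\times g:\subseteq X\times W\rightrightarrows Y\times Z$ is $(x,w)\mapsto f(x)\times g(w)$, pairs being represented via a standard computable pairing $\langle p,q\rangle$ of names. Ramsey. $[\mathbb{N}]^n$ is the set of $n$-element subsets of $\mathbb{N}$; $k$ is identified with $\{0,\dots,k-1\}$. $\mathcal{C}_{n,k}$ ($k\in\mathbb{N}$) is the set of colorings $c:[\mathbb{N}]^n\to k$ and $\mathcal{C}_{n,\mathbb{N}}$ the set of $c:[\mathbb{N}]^n\to\mathbb{N}$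 with finite range, represented by names $p$ with $p(i)=c(\vartheta_n(i))$ for a fixed standard computable bijection $\vartheta_n:\mathbb{N}\to[\mathbb{N}]^n$. $M$ is homogeneous for $c$ if $c$ is constant on $[M]^n$. $c$ is stable if $\lim_{i\to\infty}c(A\cup\{i\})$ exists for all $A\in[\mathbb{N}]^{n-1}$. $\mathrm{RT}_{n,k}:\mathcal{C}_{n,k}\rightrightarrows2^{\mathbb{N}}$ maps $c$ to the set of characteristic functions of infinite homogeneous sets for $c$; $\mathrm{SRT}_{n,k}$ is its restriction to stable colorings. *)

theory Defs
  imports Complex_Main "HOL-Library.Ramsey" "HOL-Library.Nat_Bijection"
    "HOL-Library.Extended_Nat" "HOL-Library.Indicator_Function"
begin

section \<open>Computable partial functions on Baire space\<close>

type_synonym baire = "nat \<Rightarrow> nat"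

text \<open>Unbounded search: the least \<open>m\<close> with \<open>f m = 0\<close>, provided all earlier values are defined.\<close>

definition minimization :: "(nat \<rightharpoonup> nat) \<Rightarrow> nat option" where
  "minimization f =
     (if \<exists>m. f m = Some 0 \<and> (\<forall>j<m. f j \<noteq> None)
      then Some (LEAST m. f m = Some 0) else None)"

text \<open>The functionals \<open>\<phi>\<close> that are partial recursive relative to \<open>p\<close>: the least class that contains
  the basic functions and the given \<open>p\<close> itself and is closed under composition, primitive recursion and
  minimization. All functionals are unary in their number argument; several number arguments
  are coded by the Cantor pairing \<^const>\<open>prod_encode\<close>. The closure operations act on
  \<open>\<phi>\<close> as a function of \<open>p\<close> as well, so one program serves all \<open>p\<close>.\<close>

inductive partial_recursive :: "(baire \<Rightarrow> nat \<rightharpoonup> nat) \<Rightarrow> bool" where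
  zero: "partial_recursive (\<lambda>p x. Some 0)"
| succ: "partial_recursive (\<lambda>p x. Some (Suc x))"
| left: "partial_recursive (\<lambda>p x. Some (fst (prod_decode x)))"
| right: "partial_recursive (\<lambda>p x. Some (snd (prod_decode x)))"
| query: "partial_recursive (\<lambda>p x. Some (p x))"
| pair: "\<lbrakk>partial_recursive f; partial_recursive g\<rbrakk> \<Longrightarrow>
    partial_recursive (\<lambda>p x. Option.bind (f p x) (\<lambda>a. Option.bind (g p x) (\<lambda>b. Some (prod_encode (a, b)))))"
| comp: "\<lbrakk>partial_recursive f; partial_recursive g\<rbrakk> \<Longrightarrow> partial_recursive (\<lambda>p. f p \<circ>\<^sub>m g p)"
| prim_rec: "\<lbrakk>partial_recursive f; partial_recursive g\<rbrakk> \<Longrightarrow>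
    partial_recursive (\<lambda>p x. case prod_decode x of (a, n) \<Rightarrow>
      rec_nat (f p a)
        (\<lambda>m r. Option.bind r (\<lambda>v. g p (prod_encode (a, prod_encode (m, v))))) n)"
| minim: "partial_recursive f \<Longrightarrow>
    partial_recursive (\<lambda>p a. minimization (\<lambda>m. f p (prod_encode (a, m))))"

text \<open>As usual in computable analysis, the program is only required to be correct on the domain of
  \<open>F\<close>. Since realizers may be extended, strong reducibility does not depend on this choice.\<close>

definition computable :: "(baire \<rightharpoonup> baire) \<Rightarrow> bool" where
  "computable F \<longleftrightarrow>
     (\<exists>\<phi>. partial_recursive \<phi> \<and> (\<forall>p q. F p = Some q \<longrightarrow> (\<forall>n. \<phi> p n = Some (q n))))"


section \<open>Represented spaces, problems and strong Weihrauch reducibility\<close>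

text \<open>A representation is a partial map on Baire space; the represented space is its range, so
  surjectivity is built in.\<close>

type_synonym 'a representation = "baire \<rightharpoonup> 'a"

text \<open>A problem \<open>f :\<subseteq> X \<rightrightarrows> Y\<close> with \<open>X = ran (in_rep f)\<close> and \<open>Y = ran (out_rep f)\<close>;
  its domain consists of the \<open>x\<close> with \<open>solutions f x \<noteq> {}\<close>.\<close>

record ('a, 'b) problem =
  in_rep :: "'a representation"
  out_rep :: "'b representation"
  solutions :: "'a \<Rightarrow> 'b set"

definition problem_dom :: "('a, 'b) problem \<Rightarrow> 'a set" where
  "problem_dom f = {x \<in> ran (in_rep f). solutions f x \<noteq> {}}"

definition realizes :: "(baire \<rightharpoonup> baire) \<Rightarrow> ('a, 'b) problem \<Rightarrow> bool" where
  "realizes F f \<longleftrightarrow>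
     (\<forall>p x. in_rep f p = Some x \<longrightarrow> x \<in> problem_dom f \<longrightarrow>
        (\<exists>q y. F p = Some q \<and> out_rep f q = Some y \<and> y \<in> solutions f x))"

definition strong_weihrauch_le :: "('a, 'b) problem \<Rightarrow> ('c, 'd) problem \<Rightarrow> bool"
    (infix \<open>\<le>\<^sub>s\<^sub>W\<close> 50) where
  "f \<le>\<^sub>s\<^sub>W g \<longleftrightarrow>
     (\<exists>H K. computable H \<and> computable K \<and>
        (\<forall>G. realizes G g \<longrightarrow> realizes (H \<circ>\<^sub>m G \<circ>\<^sub>m K) f))"

definition bpair :: "baire \<Rightarrow> baire \<Rightarrow> baire" where
  "bpair p q = (\<lambda>i. if even i then p (i div 2) else q (i div 2))"

definition bfst :: "baire \<Rightarrow> baire" where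
  "bfst r = (\<lambda>i. r (2 * i))"

definition bsnd :: "baire \<Rightarrow> baire" where
  "bsnd r = (\<lambda>i. r (2 * i + 1))"

lemma bfst_bpair [simp]: "bfst (bpair p q) = p"
  and bsnd_bpair [simp]: "bsnd (bpair p q) = q"
  by (auto simp: bpair_def bfst_def bsnd_def)

lemma bpair_bfst_bsnd [simp]: "bpair (bfst r) (bsnd r) = r"
  by (auto simp: bpair_def bfst_def bsnd_def fun_eq_iff)

definition prod_rep :: "'a representation \<Rightarrow> 'b representation \<Rightarrow> ('a \<times> 'b) representation" where
  "prod_rep \<delta> \<epsilon> = (\<lambda>r. case (\<delta> (bfst r), \<epsilon> (bsnd r)) of
      (Some x, Some y) \<Rightarrow> Some (x, y) | _ \<Rightarrow> None)"

lemma prod_rep_bpair: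
  "prod_rep \<delta> \<epsilon> (bpair p q) = Some (x, y) \<longleftrightarrow> \<delta> p = Some x \<and> \<epsilon> q = Some y"
  by (auto simp: prod_rep_def split: option.splits)

definition problem_prod ::
    "('a, 'b) problem \<Rightarrow> ('c, 'd) problem \<Rightarrow> ('a \<times> 'c, 'b \<times> 'd) problem"
    (infixr \<open>\<times>\<^sub>W\<close> 80) where
  "f \<times>\<^sub>W g = \<lparr>in_rep = prod_rep (in_rep f) (in_rep g),
              out_rep = prod_rep (out_rep f) (out_rep g),
              solutions = (\<lambda>(x, w). solutions f x \<times> solutions g w)\<rparr>"


section \<open>Colorings and Ramsey's theorem\<close>

text \<open>For \<open>n \<ge> 1\<close>, \<open>theta n\<close> is the bijection \<open>\<nat> \<rightarrow> [\<nat>]\<^sup>n\<close> that decodes \<open>i\<close> by iterated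
  Cantor unpairing into \<open>(d\<^sub>0, \<dots>, d\<^sub>n\<^sub>-\<^sub>1)\<close>, where \<open>d\<^sub>0\<close> is the least element of the set
  and \<open>d\<^sub>j\<^sub>+\<^sub>1\<close> is the number of naturals strictly between its consecutive elements number
  \<open>j\<close> and \<open>j + 1\<close>. The value \<open>theta 0\<close> is a dummy.\<close>

fun theta :: "nat \<Rightarrow> nat \<Rightarrow> nat set" where
  "theta 0 i = {}"
| "theta (Suc 0) i = {i}"
| "theta (Suc (Suc n)) i =
     (case prod_decode i of (a, j) \<Rightarrow> insert a ((\<lambda>x. Suc (a + x)) ` theta (Suc n) j))"

lemma bij_betw_insert_shift:
  "bij_betw (\<lambda>(a, B). insert a ((\<lambda>x. Suc (a + x)) ` B))
     (UNIV \<times> [UNIV :: nat set]\<^bsup>n\<^esup>) ([UNIV]\<^bsup>Suc n\<^esup>)"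
proof (rule bij_betw_imageI)
  let ?sh = "\<lambda>(a::nat) x. Suc (a + x)"
  let ?f = "\<lambda>(a, B). insert a (?sh a ` B)"
  have inj: "inj (?sh a)" for a by (rule injI) simp
  have mn: "(LEAST x. x \<in> insert a (?sh a ` B)) = a" for a B
    by (rule Least_equality) auto
  have rm: "insert a (?sh a ` B) - {a} = ?sh a ` B" for a B by auto
  show "inj_on ?f (UNIV \<times> [UNIV]\<^bsup>n\<^esup>)"
  proof (rule inj_onI, clarify)
    fix a B a' B'
    assume eq: "insert a (?sh a ` B) = insert a' (?sh a' ` B')"
    have a: "a = a'" using mn[of a B] mn[of a' B'] unfolding eq by simp
    have "?sh a ` B = ?sh a ` B'" using rm[of a B] rm[of a B'] eq a by metis
    then show "a = a' \<and> B = B'" using a inj_image_eq_iff[OF inj] by blast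
  qed
  show "?f ` (UNIV \<times> [UNIV]\<^bsup>n\<^esup>) = [UNIV]\<^bsup>Suc n\<^esup>"
  proof (intro equalityI subsetI)
    fix A assume "A \<in> ?f ` (UNIV \<times> [UNIV]\<^bsup>n\<^esup>)"
    then obtain a B where A: "A = insert a (?sh a ` B)" and B: "finite B" "card B = n"
      by (auto simp: nsets_def)
    have "a \<notin> ?sh a ` B" by auto
    then show "A \<in> [UNIV]\<^bsup>Suc n\<^esup>"
      using B by (simp add: A nsets_def card_image inj_on_subset[OF inj])
  next
    fix A :: "nat set" assume "A \<in> [UNIV]\<^bsup>Suc n\<^esup>"
    then have A: "finite A" "card A = Suc n" by (auto simp: nsets_def)
    then have ne: "A \<noteq> {}" by auto
    define a where "a = Min A"
    define B where "B = (\<lambda>y. y - Suc a) ` (A - {a})"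
    have aA: "a \<in> A" using A ne by (simp add: a_def)
    have gt: "a < y" if "y \<in> A - {a}" for y
      using that Min_le[OF A(1), of y] by (auto simp: a_def)
    have sh: "?sh a ` B = A - {a}"
    proof -
      have "?sh a ` B = (\<lambda>y. y) ` (A - {a})"
        unfolding B_def image_image using gt by (intro image_cong) force+
      then show ?thesis by simp
    qed
    have "card B = card (A - {a})"
      using card_image[OF inj_on_subset[OF inj[of a]], of B] sh by simp
    then have "B \<in> [UNIV]\<^bsup>n\<^esup>"
      using A aA by (simp add: nsets_def B_def)
    moreover have "A = ?f (a, B)" using sh aA by auto
    ultimately show "A \<in> ?f ` (UNIV \<times> [UNIV]\<^bsup>n\<^esup>)" by blast
  qed
qed

lemma bij_betw_theta: "n \<ge> 1 \<Longrightarrow> bij_betw (theta n) UNIV ([UNIV]\<^bsup>n\<^esup>)"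
proof (induction n rule: nat_induct_at_least)
  case base
  show ?case
    by (rule bij_betw_imageI) (auto simp: inj_on_def nsets_def card_Suc_eq)
next
  case (Suc n')
  then obtain n where n': "n' = Suc n" by (cases n') auto
  have IH: "bij_betw (theta (Suc n)) UNIV ([UNIV]\<^bsup>Suc n\<^esup>)"
    using Suc.IH by (simp add: n')
  have d: "bij_betw prod_decode UNIV (UNIV \<times> UNIV)"
    using bij_prod_decode by simp
  have m: "bij_betw (map_prod (id :: nat \<Rightarrow> nat) (theta (Suc n))) (UNIV \<times> UNIV)
             (UNIV \<times> [UNIV]\<^bsup>Suc n\<^esup>)"
    by (intro bij_betw_map_prod IH) simp
  have "theta (Suc (Suc n)) =
      (\<lambda>(a, B). insert a ((\<lambda>x. Suc (a + x)) ` B)) \<circ> (map_prod id (theta (Suc n)) \<circ> prod_decode)"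
    by (auto simp: fun_eq_iff split: prod.splits)
  then show ?case
    using bij_betw_trans[OF bij_betw_trans[OF d m] bij_betw_insert_shift] n' by metis
qed

text \<open>The number of colors is an extended natural; \<open>k = \<infinity>\<close> stands for \<open>k = \<nat>\<close>, so that
  \<open>\<infinity> + 1 = \<infinity>\<close> is the convention \<open>\<nat> + 1 = \<nat>\<close>. Finiteness of the range is a genuine condition
  only for \<open>k = \<infinity>\<close>.\<close>

definition colorings :: "nat \<Rightarrow> enat \<Rightarrow> (nat set \<Rightarrow> nat) set" where
  "colorings n k =
     {c \<in> [UNIV]\<^bsup>n\<^esup> \<rightarrow>\<^sub>E {j. enat j < k}. finite (c ` [UNIV]\<^bsup>n\<^esup>)}"

definition coloring_rep :: "nat \<Rightarrow> enat \<Rightarrow> (nat set \<Rightarrow> nat) representation" where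
  "coloring_rep n k = (\<lambda>p.
     if \<exists>c \<in> colorings n k. \<forall>i. p i = c (theta n i)
     then Some (THE c. c \<in> colorings n k \<and> (\<forall>i. p i = c (theta n i)))
     else None)"

lemma coloring_rep_eq_Some_iff:
  assumes "n \<ge> 1"
  shows "coloring_rep n k p = Some c \<longleftrightarrow> c \<in> colorings n k \<and> (\<forall>i. p i = c (theta n i))"
proof -
  have uniq: "c = d" if "c \<in> colorings n k" "\<forall>i. p i = c (theta n i)"
    "d \<in> colorings n k" "\<forall>i. p i = d (theta n i)" for c d
  proof (rule PiE_ext)
    show "c \<in> [UNIV]\<^bsup>n\<^esup> \<rightarrow>\<^sub>E {j. enat j < k}" "d \<in> [UNIV]\<^bsup>n\<^esup> \<rightarrow>\<^sub>E {j. enat j < k}"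
      using that by (auto simp: colorings_def)
    fix A :: "nat set" assume "A \<in> [UNIV]\<^bsup>n\<^esup>"
    then obtain i where "A = theta n i"
      using bij_betw_theta[OF assms] unfolding bij_betw_def by blast
    then show "c A = d A" using that by metis
  qed
  have the: "(THE c. c \<in> colorings n k \<and> (\<forall>i. p i = c (theta n i))) = d"
    if "d \<in> colorings n k" "\<forall>i. p i = d (theta n i)" for d
    using that uniq by (intro the_equality) blast+
  show ?thesis
    unfolding coloring_rep_def using the by auto
qed

definition cantor_rep :: "(nat \<Rightarrow> nat) representation" where
  "cantor_rep = (\<lambda>p. if range p \<subseteq> {0, 1} then Some p else None)"

definition homogeneous :: "nat \<Rightarrow> (nat set \<Rightarrow> nat) \<Rightarrow> nat set \<Rightarrow> bool" where
  "homogeneous n c M \<longleftrightarrow> (\<exists>j. \<forall>A \<in> [M]\<^bsup>n\<^esup>. c A = j)"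

text \<open>For \<open>i \<in> A\<close> the value \<open>c (insert i A)\<close> is arbitrary, but this affects only finitely
  many \<open>i\<close>. Convergence is in the discrete topology of \<^typ>\<open>nat\<close>.\<close>

definition stable :: "nat \<Rightarrow> (nat set \<Rightarrow> nat) \<Rightarrow> bool" where
  "stable n c \<longleftrightarrow> (\<forall>A \<in> [UNIV]\<^bsup>(n - 1)\<^esup>. convergent (\<lambda>i. c (A \<union> {i})))"

definition RT :: "nat \<Rightarrow> enat \<Rightarrow> (nat set \<Rightarrow> nat, nat \<Rightarrow> nat) problem" where
  "RT n k = \<lparr>in_rep = coloring_rep n k, out_rep = cantor_rep,
             solutions = (\<lambda>c. {indicator M | M. c \<in> colorings n k \<and> infinite M \<and> homogeneous n c M})\<rparr>"

definition SRT :: "nat \<Rightarrow> enat \<Rightarrow> (nat set \<Rightarrow> nat, nat \<Rightarrow> nat) problem" where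
  "SRT n k = RT n k \<lparr>solutions := (\<lambda>c. if stable n c then solutions (RT n k) c else {})\<rparr>"

end

theory Submission
  imports Defs
begin

text \<open>Merge colorings \<open>c\<^sub>1\<close> of \<open>n\<close>-sets and \<open>c\<^sub>2\<close> of \<open>(n + 1)\<close>-sets into one coloring of
  \<open>(n + 1)\<close>-sets: \<open>A\<close> gets color \<open>c\<^sub>2 A + 1\<close> if \<open>A\<close> is homogeneous for \<open>c\<^sub>1\<close>, and the additional
  color \<open>0\<close> otherwise. By Ramsey's theorem an infinite homogeneous set \<open>M\<close> of the merged coloring
  contains an infinite homogeneous set \<open>Y\<close> for \<open>c\<^sub>1\<close>, so its color is not \<open>0\<close>. Hence \<open>M\<close> is
  homogeneous for \<open>c\<^sub>2\<close>, and exchanging one element at a time moves every \<open>n\<close>-subset of \<open>M\<close> into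
  \<open>Y\<close> without changing its color under \<open>c\<^sub>1\<close>. The same \<open>M\<close> thus solves both problems.\<close>

section \<open>Total recursive functionals\<close>

definition total_recursive :: "(baire \<Rightarrow> nat \<Rightarrow> nat) \<Rightarrow> bool" where
  "total_recursive f \<longleftrightarrow> partial_recursive (\<lambda>p x. Some (f p x))"

lemma computable_total: "total_recursive f \<Longrightarrow> computable (\<lambda>p. Some (f p))"
  unfolding computable_def total_recursive_def by fastforce

lemma total_recursive_comp:
  assumes "total_recursive f" "total_recursive g"
  shows "total_recursive (\<lambda>p x. f p (g p x))"
  using partial_recursive.comp[OF assms[unfolded total_recursive_def]]
  by (simp add: total_recursive_def map_comp_def)

lemma total_recursive_pair:
  assumes "total_recursive f" "total_recursive g"
  shows "total_recursive (\<lambda>p x. prod_encode (f p x, g p x))"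
  using partial_recursive.pair[OF assms[unfolded total_recursive_def]]
  by (simp add: total_recursive_def)

lemma total_recursive_fst:
  "total_recursive f \<Longrightarrow> total_recursive (\<lambda>p x. fst (prod_decode (f p x)))"
  by (rule total_recursive_comp) (simp_all add: total_recursive_def partial_recursive.left)

lemma total_recursive_snd:
  "total_recursive f \<Longrightarrow> total_recursive (\<lambda>p x. snd (prod_decode (f p x)))"
  by (rule total_recursive_comp) (simp_all add: total_recursive_def partial_recursive.right)

lemma total_recursive_Suc:
  "total_recursive f \<Longrightarrow> total_recursive (\<lambda>p x. Suc (f p x))"
  by (rule total_recursive_comp) (simp_all add: total_recursive_def partial_recursive.succ)

lemma total_recursive_query:
  "total_recursive f \<Longrightarrow> total_recursive (\<lambda>p x. p (f p x))"
  by (rule total_recursive_comp) (simp_all add: total_recursive_def partial_recursive.query)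

lemma total_recursive_zero: "total_recursive (\<lambda>p x. 0)"
  by (simp add: total_recursive_def partial_recursive.zero)

lemma total_recursive_id: "total_recursive (\<lambda>p x. x)"
proof -
  have "total_recursive (\<lambda>p x. prod_encode (fst (prod_decode x), snd (prod_decode x)))"
    by (rule total_recursive_pair)
      (simp_all add: total_recursive_def partial_recursive.left partial_recursive.right)
  then show ?thesis by simp
qed

text \<open>Recursion in the basic class runs on a coded pair of parameter and counter. Taking
  \<open>x\<close> itself as the parameter lets base, step and counter all depend on
  \<open>x\<close>.\<close>

lemma total_recursive_rec_nat:
  assumes f: "total_recursive f" and b: "total_recursive b"
    and g: "total_recursive (\<lambda>p z. g p (fst (prod_decode z))
      (fst (prod_decode (snd (prod_decode z)))) (snd (prod_decode (snd (prod_decode z)))))"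
  shows "total_recursive (\<lambda>p x. rec_nat (f p x) (\<lambda>m v. g p x m v) (b p x))"
proof -
  \<comment> \<open>With total ingredients the option-valued recursion never meets
    \<open>None\<close>.\<close>
  have "rec_nat (Some y) (\<lambda>m r. Option.bind r (\<lambda>v. Some (h m v))) n = Some (rec_nat y h n)"
    for y n and h :: "nat \<Rightarrow> nat \<Rightarrow> nat"
    by (induction n) auto
  then have "total_recursive (\<lambda>p z. rec_nat (f p (fst (prod_decode z)))
      (g p (fst (prod_decode z))) (snd (prod_decode z)))"
    using partial_recursive.prim_rec[OF f[unfolded total_recursive_def] g[unfolded total_recursive_def]]
    by (simp add: total_recursive_def case_prod_unfold)
  from total_recursive_comp[OF this total_recursive_pair[OF total_recursive_id b]]
  show ?thesis by simp
qed

lemmas total_recursive_basic =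
  total_recursive_zero total_recursive_id total_recursive_Suc total_recursive_query
  total_recursive_fst total_recursive_snd total_recursive_pair

section \<open>Arithmetic and tests for zero\<close>

lemma total_recursive_add:
  assumes "total_recursive f" "total_recursive g"
  shows "total_recursive (\<lambda>p x. f p x + g p x)"
proof -
  have "total_recursive (\<lambda>p x. rec_nat (f p x) (\<lambda>m v. Suc v) (g p x))"
    by (rule total_recursive_rec_nat) (intro total_recursive_basic assms)+
  moreover have "rec_nat a (\<lambda>m v. Suc v) b = a + b" for a b by (induction b) auto
  ultimately show ?thesis by simp
qed

lemma total_recursive_pred:
  assumes "total_recursive f"
  shows "total_recursive (\<lambda>p x. f p x - 1)"
proof -
  have "total_recursive (\<lambda>p x. rec_nat 0 (\<lambda>m v. m) (f p x))"
    by (rule total_recursive_rec_nat) (intro total_recursive_basic assms)+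
  moreover have "rec_nat 0 (\<lambda>m v. m) b = b - 1" for b by (induction b) auto
  ultimately show ?thesis by simp
qed

lemma total_recursive_diff:
  assumes "total_recursive f" "total_recursive g"
  shows "total_recursive (\<lambda>p x. f p x - g p x)"
proof -
  have "total_recursive (\<lambda>p x. rec_nat (f p x) (\<lambda>m v. v - 1) (g p x))"
    by (rule total_recursive_rec_nat) (intro total_recursive_basic total_recursive_pred assms)+
  moreover have "rec_nat a (\<lambda>m v. v - 1) b = a - b" for a b :: nat by (induction b) auto
  ultimately show ?thesis by simp
qed

lemma total_recursive_if_zero:
  assumes "total_recursive d" "total_recursive f"
  shows "total_recursive (\<lambda>p x. if d p x = 0 then f p x else 0)"
proof -
  have "total_recursive (\<lambda>p x. rec_nat (f p x) (\<lambda>m v. 0) (d p x))"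
    by (rule total_recursive_rec_nat) (intro total_recursive_basic assms)+
  moreover have "rec_nat a (\<lambda>m v. 0) b = (if b = 0 then a else 0)" for a b :: nat
    by (induction b) auto
  ultimately show ?thesis by simp
qed

text \<open>The bound \<open>n\<close> is a constant, so the sum unfolds into finitely many
  additions, and each \<open>f j\<close> may be a different program.\<close>

lemma total_recursive_sum:
  fixes n :: nat
  assumes "\<And>j. total_recursive (f j)"
  shows "total_recursive (\<lambda>p x. \<Sum>j\<le>n. f j p x)"
  by (induction n) (simp_all add: assms total_recursive_add)

lemma total_recursive_mod2:
  assumes "total_recursive f"
  shows "total_recursive (\<lambda>p x. f p x mod 2)"
proof -
  \<comment> \<open>Starting from 0, each step exchanges 0 and 1.\<close>
  have "total_recursive (\<lambda>p x. rec_nat 0 (\<lambda>m v. Suc 0 - v) (f p x))"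
    by (rule total_recursive_rec_nat) (intro total_recursive_basic total_recursive_diff assms)+
  moreover have "rec_nat 0 (\<lambda>m v. Suc 0 - v) b = b mod 2" for b
    by (induction b) (auto simp: mod_Suc)
  ultimately show ?thesis by simp
qed

lemma total_recursive_div2:
  assumes "total_recursive f"
  shows "total_recursive (\<lambda>p x. f p x div 2)"
proof -
  \<comment> \<open>\<open>b div 2\<close> counts the odd numbers below \<open>b\<close>.\<close>
  have "total_recursive (\<lambda>p x. rec_nat 0 (\<lambda>m v. v + m mod 2) (f p x))"
    by (rule total_recursive_rec_nat)
      (intro total_recursive_basic total_recursive_add total_recursive_mod2 assms)+
  moreover have "rec_nat 0 (\<lambda>m v. v + m mod 2) b = b div 2" for b :: nat
    by (induction b) (simp, simp, presburger)
  ultimately show ?thesis by simp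
qed


section \<open>Codes of subsets\<close>

text \<open>The \<^const>\<open>theta\<close>-code of \<open>theta (n + 1) i\<close> without its \<open>j\<close>-th element, counted from \<open>0\<close> in
  increasing order; \<open>n = 0\<close> is a dummy case. Deleting the least element merges the first two gaps.\<close>

fun theta_del :: "nat \<Rightarrow> nat \<Rightarrow> nat \<Rightarrow> nat" where
  "theta_del 0 j i = 0"
| "theta_del (Suc 0) 0 i = Suc (fst (prod_decode i) + snd (prod_decode i))"
| "theta_del (Suc 0) (Suc j) i = fst (prod_decode i)"
| "theta_del (Suc (Suc n)) 0 i =
     prod_encode (Suc (fst (prod_decode i) + fst (prod_decode (snd (prod_decode i)))),
       snd (prod_decode (snd (prod_decode i))))"
| "theta_del (Suc (Suc n)) (Suc j) i =
     prod_encode (fst (prod_decode i), theta_del (Suc n) j (snd (prod_decode i)))"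

lemma total_recursive_theta_del:
  "total_recursive f \<Longrightarrow> total_recursive (\<lambda>p x. theta_del n j (f p x))"
proof (induction n arbitrary: j f)
  case (Suc n)
  then show ?case
    by (cases n; cases j) (simp_all add: total_recursive_basic total_recursive_add)
qed (simp add: total_recursive_zero)

text \<open>Homogeneity depends only on the set of all one-element deletions, so these are compared
  as a whole. In the induction, index 0 removes the least element, and index \<open>Suc j\<close>
  removes element \<open>j\<close> of the shifted tail.\<close>

lemma theta_theta_del_image:
  "(\<lambda>j. theta (Suc n) (theta_del (Suc n) j i)) ` {..Suc n} =
     (\<lambda>a. theta (Suc (Suc n)) i - {a}) ` theta (Suc (Suc n)) i"
proof (induction n arbitrary: i)
  case 0
  obtain a b where "prod_decode i = (a, b)" by fastforce
  then show ?case by (auto simp: atMost_Suc)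
next
  case (Suc n)
  obtain a i' where i: "prod_decode i = (a, i')" by fastforce
  define B where "B = theta (Suc (Suc n)) i'"
  define S where "S = (\<lambda>x. Suc (a + x))"
  have th: "theta (Suc (Suc (Suc n))) i = insert a (S ` B)"
    by (simp add: i B_def S_def)
  have aS: "a \<notin> S ` X" for X by (auto simp: S_def)
  have injS: "inj S" by (auto simp: S_def inj_on_def)
  \<comment> \<open>The merged first entry is the second least element of the set; the later gaps
    stay the same.\<close>
  have z: "theta (Suc (Suc n)) (theta_del (Suc (Suc n)) 0 i) = S ` B"
    by (auto simp: i B_def S_def image_image split: prod.splits)
  have s: "theta (Suc (Suc n)) (theta_del (Suc (Suc n)) (Suc j) i) =
      insert a (S ` theta (Suc n) (theta_del (Suc n) j i'))" for j
    by (simp add: i S_def)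
  have "(\<lambda>j. theta (Suc (Suc n)) (theta_del (Suc (Suc n)) j i)) ` {..Suc (Suc n)} =
      insert (S ` B) ((\<lambda>X. insert a (S ` X)) `
        (\<lambda>j. theta (Suc n) (theta_del (Suc n) j i')) ` {..Suc n})"
    unfolding atMost_Suc_eq_insert_0[of "Suc n"] image_insert image_image z s ..
  also have "\<dots> = insert (S ` B) ((\<lambda>b. insert a (S ` (B - {b}))) ` B)"
    unfolding Suc.IH B_def image_image ..
  also have "\<dots> = (\<lambda>b. insert a (S ` B) - {b}) ` insert a (S ` B)"
  proof -
    \<comment> \<open>\<open>S\<close> is injective and misses \<open>a\<close>, so deletion
      commutes with the shift.\<close>
    have "insert a (S ` (B - {b})) = insert a (S ` B) - {S b}" for b
      using aS[of B] injS by (auto simp: inj_def S_def)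
    moreover have "insert a (S ` B) - {a} = S ` B" using aS by auto
    ultimately show ?thesis by (simp add: image_image)
  qed
  finally show ?case by (simp only: th)
qed

lemma nsets_eq_image_remove:
  assumes "finite A" "card A = Suc n"
  shows "[A]\<^bsup>n\<^esup> = (\<lambda>a. A - {a}) ` A"
proof (intro equalityI subsetI)
  fix B assume "B \<in> [A]\<^bsup>n\<^esup>"
  then have B: "B \<subseteq> A" "finite B" "card B = n" by (auto simp: nsets_def)
  then have "card (A - B) = 1" using assms by (simp add: card_Diff_subset)
  then obtain a where "A - B = {a}" by (auto simp: card_1_singleton_iff)
  then have "a \<in> A" "B = A - {a}" using B by auto
  then show "B \<in> (\<lambda>a. A - {a}) ` A" by blast
qed (use assms in \<open>auto simp: nsets_def\<close>)

lemma theta_in_nsets: "n \<ge> 1 \<Longrightarrow> theta n i \<in> [UNIV]\<^bsup>n\<^esup>"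
  using bij_betw_theta[of n] unfolding bij_betw_def by blast

text \<open>Turns homogeneity of a coded set into a condition on \<open>n + 1\<close> computable
  codes.\<close>

lemma nsets_theta:
  assumes "n \<ge> 1"
  shows "[theta (Suc n) i]\<^bsup>n\<^esup> = (\<lambda>j. theta n (theta_del n j i)) ` {..n}"
proof -
  have "finite (theta (Suc n) i)" "card (theta (Suc n) i) = Suc n"
    using theta_in_nsets[of "Suc n" i] by (auto simp: nsets_def)
  moreover obtain m where "n = Suc m" using assms by (cases n) auto
  ultimately show ?thesis
    using nsets_eq_image_remove theta_theta_del_image by metis
qed


section \<open>The merged coloring\<close>

definition merge :: "nat \<Rightarrow> (nat set \<Rightarrow> nat) \<Rightarrow> (nat set \<Rightarrow> nat) \<Rightarrow> nat set \<Rightarrow> nat" where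
  "merge n c d =
     restrict (\<lambda>A. if homogeneous n c A then Suc (d A) else 0) ([UNIV]\<^bsup>Suc n\<^esup>)"

lemma merge_in_colorings:
  assumes "d \<in> colorings (Suc n) k"
  shows "merge n c d \<in> colorings (Suc n) (k + 1)"
proof -
  \<comment> \<open>At most one color is added. Finiteness of the range is carried along because for
    \<open>k = \<infinity>\<close> the color bound does not give it.\<close>
  have "merge n c d ` [UNIV]\<^bsup>Suc n\<^esup> \<subseteq> insert 0 (Suc ` d ` [UNIV]\<^bsup>Suc n\<^esup>)"
    by (auto simp: merge_def)
  moreover have "finite (d ` [UNIV]\<^bsup>Suc n\<^esup>)" using assms by (simp add: colorings_def)
  ultimately have "finite (merge n c d ` [UNIV]\<^bsup>Suc n\<^esup>)"
    by (meson finite_imageI finite_insert finite_subset)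
  moreover have "enat (Suc j) < k + 1" if "enat j < k" for j
    using that by (cases k) (auto simp: one_enat_def)
  moreover have "enat 0 < k + 1"
    by (cases k) (auto simp: one_enat_def)
  ultimately show ?thesis
    using assms unfolding colorings_def by (auto simp: merge_def PiE_iff)
qed

lemma exists_infinite_homogeneous:
  assumes "c \<in> colorings n k" "infinite M"
  obtains Y where "Y \<subseteq> M" "infinite Y" "homogeneous n c Y"
proof -
  \<comment> \<open>A finite range is bounded, so Ramsey's theorem for finitely many colors applies
    even when \<open>k = \<infinity>\<close>.\<close>
  obtain s where s: "\<forall>A \<in> [UNIV]\<^bsup>n\<^esup>. c A < s"
    using assms(1) unfolding colorings_def
    by (metis (no_types, lifting) finite_nat_set_iff_bounded image_eqI mem_Collect_eq)
  have "\<forall>X. X \<subseteq> M \<and> finite X \<and> card X = n \<longrightarrow> c X < s"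
    using s by (auto simp: nsets_def)
  from Ramsey[OF assms(2) this] obtain Y t where "Y \<subseteq> M" "infinite Y"
    "\<forall>X. X \<subseteq> Y \<and> finite X \<and> card X = n \<longrightarrow> c X = t" by blast
  then show thesis
    by (intro that[of Y]) (auto simp: homogeneous_def nsets_def)
qed

lemma homogeneous_mergeD:
  assumes c: "c \<in> colorings n l" and M: "infinite M"
    and hom: "homogeneous (Suc n) (merge n c d) M"
  shows "homogeneous n c M" "homogeneous (Suc n) d M"
proof -
  obtain Y where Y: "Y \<subseteq> M" "infinite Y" "homogeneous n c Y"
    using exists_infinite_homogeneous[OF c M] .
  then obtain v where v: "\<And>A. A \<in> [Y]\<^bsup>n\<^esup> \<Longrightarrow> c A = v" by (auto simp: homogeneous_def)
  obtain j where j: "\<And>A. A \<in> [M]\<^bsup>Suc n\<^esup> \<Longrightarrow> merge n c d A = j"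
    using hom by (auto simp: homogeneous_def)
  have sub: "A \<in> [UNIV]\<^bsup>Suc n\<^esup>" if "A \<in> [M]\<^bsup>Suc n\<^esup>" for A
    using that by (auto simp: nsets_def)
  \<comment> \<open>Any \<open>n + 1\<close> elements of \<open>Y\<close> form a set homogeneous for
    \<open>c\<close>, which rules out color 0 on \<open>M\<close>.\<close>
  obtain A0 where A0: "A0 \<subseteq> Y" "finite A0" "card A0 = Suc n"
    using infinite_arbitrarily_large[OF Y(2)] by blast
  then have "homogeneous n c A0"
    using v by (auto simp: homogeneous_def nsets_def)
  moreover have A0M: "A0 \<in> [M]\<^bsup>Suc n\<^esup>" using A0 Y(1) by (auto simp: nsets_def)
  ultimately have jpos: "j = Suc (d A0)" using j[OF A0M] sub[OF A0M] by (simp add: merge_def)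
  \<comment> \<open>Since \<open>j\<close> is positive, the first branch of \<open>merge\<close>
    applies to every \<open>A\<close>.\<close>
  have A: "homogeneous n c A \<and> Suc (d A) = j" if "A \<in> [M]\<^bsup>Suc n\<^esup>" for A
    using j[OF that] sub[OF that] jpos by (auto simp: merge_def split: if_splits)
  then show "homogeneous (Suc n) d M"
    unfolding homogeneous_def by (metis Suc_inject jpos)
  \<comment> \<open>Induction on the number of elements of \<open>B\<close> outside
    \<open>Y\<close>.\<close>
  have "c B = v" if "B \<in> [M]\<^bsup>n\<^esup>" for B
    using that
  proof (induction "card (B - Y)" arbitrary: B rule: less_induct)
    case less
    then have B: "B \<subseteq> M" "finite B" "card B = n" by (auto simp: nsets_def)
    show ?case
    proof (cases "B \<subseteq> Y")
      case True
      then show ?thesis using B v by (auto simp: nsets_def)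
    next
      case False
      then obtain b where b: "b \<in> B" "b \<notin> Y" by blast
      obtain y where y: "y \<in> Y" "y \<notin> B"
        using Y(2) B(2) by (meson finite_subset subsetI)
      \<comment> \<open>Exchanges \<open>b\<close> for \<open>y\<close>: \<open>insert y B\<close>
        has \<open>n + 1\<close> elements and contains both \<open>B\<close> and \<open>B'\<close>,
        so these share their color.\<close>
      define B' where "B' = insert y B - {b}"
      have eq: "B' - Y = (B - Y) - {b}" using y by (auto simp: B'_def)
      have "card (B' - Y) < card (B - Y)"
        unfolding eq using b B(2) by (intro card_Diff1_less) auto
      moreover have B': "B' \<in> [M]\<^bsup>n\<^esup>"
        using B b y Y(1) by (auto simp: nsets_def B'_def card_Diff_singleton_if)
      ultimately have "c B' = v" using less.hyps by blast
      moreover have "insert y B \<in> [M]\<^bsup>Suc n\<^esup>" using B y Y(1) by (auto simp: nsets_def)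
      then have "homogeneous n c (insert y B)" using A by blast
      moreover have "B \<in> [insert y B]\<^bsup>n\<^esup>" "B' \<in> [insert y B]\<^bsup>n\<^esup>"
        using B B' by (auto simp: nsets_def B'_def)
      ultimately show ?thesis unfolding homogeneous_def by metis
    qed
  qed
  then show "homogeneous n c M" by (auto simp: homogeneous_def)
qed

section \<open>Preservation of stability under merging\<close>

lemma convergent_discrete_iff:
  fixes f :: "nat \<Rightarrow> 'a::discrete_topology"
  shows "convergent f \<longleftrightarrow> (\<exists>l. eventually (\<lambda>i. f i = l) sequentially)"
  by (simp add: convergent_def tendsto_discrete)

text \<open>For \<open>i\<close> outside an n-set \<open>A\<close>, the n-subsets of
  \<open>insert i A\<close> are \<open>A\<close> and the sets \<open>insert i (A - {a})\<close>.
  Their colors under \<open>c\<close> stabilize, and there are finitely many, so homogeneity of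
  \<open>insert i A\<close> is eventually constant, as is its color under \<open>d\<close>.\<close>

lemma stable_merge:
  assumes n: "n \<ge> 1" and c: "stable n c" and d: "stable (Suc n) d"
  shows "stable (Suc n) (merge n c d)"
  unfolding stable_def
proof
  fix A :: "nat set" assume "A \<in> [UNIV]\<^bsup>(Suc n - 1)\<^esup>"
  then have A: "finite A" "card A = n" by (auto simp: nsets_def)
  have "\<exists>l. eventually (\<lambda>i. c (insert i (A - {a})) = l) sequentially" if "a \<in> A" for a
  proof -
    have "A - {a} \<in> [UNIV]\<^bsup>(n - 1)\<^esup>" using A that by (auto simp: nsets_def)
    then show ?thesis using c by (auto simp: stable_def convergent_discrete_iff)
  qed
  then obtain l where l: "\<And>a. a \<in> A \<Longrightarrow> eventually (\<lambda>i. c (insert i (A - {a})) = l a) sequentially"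
    by metis
  have lA: "eventually (\<lambda>i. \<forall>a\<in>A. c (insert i (A - {a})) = l a) sequentially"
    using l A by (simp add: eventually_ball_finite)
  obtain m where m: "eventually (\<lambda>i. d (insert i A) = m) sequentially"
    using d A by (auto simp: stable_def convergent_discrete_iff nsets_def)
  \<comment> \<open>Excludes the finitely many \<open>i\<close> for which \<open>insert i A\<close>
    has only \<open>n\<close> elements.\<close>
  have "eventually (\<lambda>i. i \<notin> A) sequentially"
    using A(1) by (metis eventually_sequentially finite_nat_set_iff_bounded leD)
  with lA m have "eventually (\<lambda>i. merge n c d (insert i A) =
      (if \<forall>a\<in>A. l a = c A then Suc m else 0)) sequentially"
  proof eventually_elim
    case (elim i)
    have i: "insert i A \<in> [UNIV]\<^bsup>Suc n\<^esup>" using elim A by (simp add: nsets_def)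
    have "[insert i A]\<^bsup>n\<^esup> = (\<lambda>a. insert i A - {a}) ` insert i A"
      using elim A by (intro nsets_eq_image_remove) auto
    also have "\<dots> = insert A ((\<lambda>a. insert i (A - {a})) ` A)"
      using elim by (force simp: insert_Diff_if)
    finally have "homogeneous n c (insert i A) \<longleftrightarrow> (\<forall>a\<in>A. l a = c A)"
      using elim by (auto simp: homogeneous_def)
    then show ?case using elim i by (simp add: merge_def)
  qed
  then show "convergent (\<lambda>i. merge n c d (A \<union> {i}))"
    by (auto simp: convergent_discrete_iff)
qed

section \<open>Computing the merged coloring on names\<close>

definition merge_name :: "nat \<Rightarrow> baire \<Rightarrow> baire" where
  "merge_name n r i =
     (if \<forall>j\<le>n. bfst r (theta_del n j i) = bfst r (theta_del n 0 i) then Suc (bsnd r i) else 0)"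

text \<open>By \<open>nsets_theta\<close>, homogeneity means that \<open>n + 1\<close> entries of
  the first name agree; the entry for index 0 serves as the reference value.\<close>

lemma merge_name_eq_merge:
  assumes "n \<ge> 1" "\<forall>i. bfst r i = c (theta n i)" "\<forall>i. bsnd r i = d (theta (Suc n) i)"
  shows "merge_name n r i = merge n c d (theta (Suc n) i)"
proof -
  have "homogeneous n c (theta (Suc n) i) \<longleftrightarrow>
      (\<exists>v. \<forall>j\<le>n. bfst r (theta_del n j i) = v)"
    unfolding homogeneous_def nsets_theta[OF assms(1)] ball_simps atMost_iff Ball_def[of "{..n}"]
    by (simp only: assms(2))
  also have "\<dots> \<longleftrightarrow> (\<forall>j\<le>n. bfst r (theta_del n j i) = bfst r (theta_del n 0 i))"
    by (metis le0)
  finally show ?thesis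
    unfolding merge_name_def using theta_in_nsets[of "Suc n" i] by (simp only: merge_def assms(3)) simp
qed

lemma computable_merge_name: "computable (\<lambda>r. Some (merge_name n r))"
proof (rule computable_total)
  define u where "u j r i = bfst r (theta_del n j i)" for j r i
  have u: "total_recursive (u j)" for j
    unfolding u_def bfst_def mult_2
    by (intro total_recursive_query total_recursive_add total_recursive_theta_del total_recursive_id)
  \<comment> \<open>The two truncated differences add up to the absolute difference, so one zero
    test decides all the equalities.\<close>
  have iff: "(\<Sum>j\<le>n. (u j r i - u 0 r i) + (u 0 r i - u j r i)) = 0 \<longleftrightarrow>
      (\<forall>j\<le>n. u j r i = u 0 r i)" for r i
  proof -
    have "(a - b) + (b - a) = 0 \<longleftrightarrow> a = b" for a b :: nat by arith
    then show ?thesis by (simp only: sum_eq_0_iff[OF finite_atMost] Ball_def atMost_iff)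
  qed
  have "total_recursive (\<lambda>r i. if (\<Sum>j\<le>n. (u j r i - u 0 r i) + (u 0 r i - u j r i)) = 0
      then Suc (r (Suc (i + i))) else 0)"
    by (intro total_recursive_if_zero total_recursive_sum total_recursive_add total_recursive_diff
        total_recursive_basic u)
  then show "total_recursive (merge_name n)"
    unfolding iff merge_name_def[abs_def] u_def[symmetric] bsnd_def mult_2 Suc_eq_plus1[symmetric] .
qed

text \<open>The outer functional of the reduction: one homogeneous set answers both components, so
  its name is duplicated.\<close>

lemma computable_diagonal: "computable (\<lambda>q. Some (bpair q q))"
proof -
  have "bpair q q = (\<lambda>i. q (i div 2))" for q by (auto simp: bpair_def)
  then show ?thesis
    using computable_total[OF total_recursive_query[OF total_recursive_div2[OF total_recursive_id]]]
    by simp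
qed


section \<open>The reduction\<close>

text \<open>Treats the plain and the stable problems uniformly; colorings outside \<open>S\<close>
  leave the domain because they get no solutions.\<close>

definition RT_on :: "((nat set \<Rightarrow> nat) \<Rightarrow> bool) \<Rightarrow> nat \<Rightarrow> enat \<Rightarrow> (nat set \<Rightarrow> nat, nat \<Rightarrow> nat) problem" where
  "RT_on S n k = RT n k \<lparr>solutions := (\<lambda>c. if S c then solutions (RT n k) c else {})\<rparr>"

text \<open>Compatibility of the three classes with merging keeps the merged coloring in the domain
  of the target; the rest of the argument is common to both versions.\<close>

lemma RT_on_prod_le:
  assumes n: "n \<ge> 1" and S: "\<And>c d. S\<^sub>1 c \<Longrightarrow> S\<^sub>2 d \<Longrightarrow> S\<^sub>3 (merge n c d)"
  shows "RT_on S\<^sub>1 n l \<times>\<^sub>W RT_on S\<^sub>2 (Suc n) k \<le>\<^sub>s\<^sub>W RT_on S\<^sub>3 (Suc n) (k + 1)"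
  unfolding strong_weihrauch_le_def
proof (intro exI conjI allI impI)
  fix G assume G: "realizes G (RT_on S\<^sub>3 (Suc n) (k + 1))"
  show "realizes ((\<lambda>q. Some (bpair q q)) \<circ>\<^sub>m G \<circ>\<^sub>m (\<lambda>r. Some (merge_name n r)))
      (RT_on S\<^sub>1 n l \<times>\<^sub>W RT_on S\<^sub>2 (Suc n) k)"
    unfolding realizes_def
  proof (intro allI impI)
    fix r x
    assume x: "in_rep (RT_on S\<^sub>1 n l \<times>\<^sub>W RT_on S\<^sub>2 (Suc n) k) r = Some x"
      and dom: "x \<in> problem_dom (RT_on S\<^sub>1 n l \<times>\<^sub>W RT_on S\<^sub>2 (Suc n) k)"
    obtain c d where xcd: "x = (c, d)" by fastforce
    have "coloring_rep n l (bfst r) = Some c" "coloring_rep (Suc n) k (bsnd r) = Some d"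
      using x xcd
      by (auto simp: problem_prod_def RT_on_def RT_def prod_rep_def split: option.splits)
    then have c: "c \<in> colorings n l" "\<forall>i. bfst r i = c (theta n i)"
      and d: "d \<in> colorings (Suc n) k" "\<forall>i. bsnd r i = d (theta (Suc n) i)"
      using n by (simp_all add: coloring_rep_eq_Some_iff)
    have Scd: "S\<^sub>1 c" "S\<^sub>2 d"
      using dom xcd by (auto simp: problem_dom_def problem_prod_def RT_on_def split: if_splits)
    let ?e = "merge n c d"
    have e: "?e \<in> colorings (Suc n) (k + 1)" using d(1) by (rule merge_in_colorings)
    have rep: "coloring_rep (Suc n) (k + 1) (merge_name n r) = Some ?e"
      using e merge_name_eq_merge[OF n c(2) d(2)] by (simp add: coloring_rep_eq_Some_iff)
    \<comment> \<open>\<open>G\<close> is constrained only on the domain, so a solution for the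
      merged coloring must be known to exist first.\<close>
    obtain Y :: "nat set" where "infinite Y" "homogeneous (Suc n) ?e Y"
      using exists_infinite_homogeneous[OF e infinite_UNIV_nat] by metis
    then have "?e \<in> problem_dom (RT_on S\<^sub>3 (Suc n) (k + 1))"
      using e rep S[OF Scd] by (auto simp: problem_dom_def RT_on_def RT_def ran_def)
    moreover have "in_rep (RT_on S\<^sub>3 (Suc n) (k + 1)) (merge_name n r) = Some ?e"
      using rep by (simp add: RT_on_def RT_def)
    ultimately obtain q y where q: "G (merge_name n r) = Some q" and
      y: "out_rep (RT_on S\<^sub>3 (Suc n) (k + 1)) q = Some y"
        "y \<in> solutions (RT_on S\<^sub>3 (Suc n) (k + 1)) ?e"
      using G unfolding realizes_def by blast
    obtain M where M: "y = indicator M" "infinite M" "homogeneous (Suc n) ?e M"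
      using y(2) by (auto simp: RT_on_def RT_def split: if_splits)
    have "homogeneous n c M" "homogeneous (Suc n) d M"
      using homogeneous_mergeD[OF c(1) M(2,3)] .
    then have "(y, y) \<in> solutions (RT_on S\<^sub>1 n l \<times>\<^sub>W RT_on S\<^sub>2 (Suc n) k) x"
      using xcd Scd c(1) d(1) M by (auto simp: problem_prod_def RT_on_def RT_def)
    moreover have "out_rep (RT_on S\<^sub>1 n l \<times>\<^sub>W RT_on S\<^sub>2 (Suc n) k) (bpair q q) = Some (y, y)"
      using y(1) by (simp add: problem_prod_def RT_on_def RT_def prod_rep_bpair)
    ultimately show "\<exists>q y. ((\<lambda>q. Some (bpair q q)) \<circ>\<^sub>m G \<circ>\<^sub>m (\<lambda>r. Some (merge_name n r))) r = Some q \<and>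
        out_rep (RT_on S\<^sub>1 n l \<times>\<^sub>W RT_on S\<^sub>2 (Suc n) k) q = Some y \<and>
        y \<in> solutions (RT_on S\<^sub>1 n l \<times>\<^sub>W RT_on S\<^sub>2 (Suc n) k) x"
      using q by auto
  qed
qed (rule computable_diagonal computable_merge_name)+

theorem theorem3p24:
  fixes n :: nat and k :: enat
  assumes "n \<ge> 1" and "k \<ge> 1"
  shows "RT n \<infinity> \<times>\<^sub>W RT (n + 1) k \<le>\<^sub>s\<^sub>W RT (n + 1) (k + 1) \<and>
         SRT n \<infinity> \<times>\<^sub>W SRT (n + 1) k \<le>\<^sub>s\<^sub>W SRT (n + 1) (k + 1)"
proof -
  have RT: "RT m j = RT_on (\<lambda>_. True) m j" for m j by (simp add: RT_on_def)
  have SRT: "SRT m j = RT_on (stable m) m j" for m j by (simp add: RT_on_def SRT_def)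
  show ?thesis
    unfolding RT SRT Suc_eq_plus1[symmetric]
    by (intro conjI RT_on_prod_le assms(1) stable_merge TrueI)
qed

end
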